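(* Let $\pi(\cdot\mid\mathbf y)$ be a posterior density on $\mathbb R^m$ with mode $\boldsymbol\vartheta^*$, let $\mathbf H(\boldsymbol\vartheta)=-\nabla^2\log\pi(\boldsymbol\vartheta\mid\mathbf y)$ with $\mathbf H(\boldsymbol\vartheta^* )$ positive definite, put $\boldsymbol\Omega=\mathbf H(\boldsymbol\vartheta^* )^{-1}=\mathbf L\mathbf L^\top$, and let $\mathbf g(\boldsymbol\vartheta)=-\nabla\log\pi(\boldsymbol\vartheta\mid\mathbf y)$, so that $\mathbf H(\boldsymbol\vartheta)=\nabla\mathbf g(\boldsymbol\vartheta)$ and, for any fixed direction $\mathbf u\in\mathbb R^m$, $\mathbf u^\top\mathbf H(\boldsymbol\vartheta)\mathbf u=\mathbf u^\top\frac{d}{d\mathbf u}\mathbf g(\boldsymbol\vartheta)$, where $\frac{d}{d\mathbf u}$ is the directional derivative along $\mathbf u$. Fix $j\in\{1,\dots,m\}$, let $\mathbf v_j=\boldsymbol\Omega_{\cdot j}/\sqrt{\Omega_{jj}}$ and $\boldsymbol\vartheta(t)=\boldsymbol\vartheta^*+t\,\mathbf v_j$, and let $\gamma_j'=\frac{d}{dt}\big(-\tfrac12\log|\mathbf H_{-j}(t)|\big)\big|_{t=0}$ be the volume slope. Then $$\gamma_j'=-\frac12\sum_{k=1}^m\frac{d}{dt}\left[\mathbf L_{\cdot k}^\top\,\frac{d}{d\mathbf L_{\cdot k}}\mathbf g(\boldsymbol\vartheta(t))\right]_{t=0}+\frac12\,\frac{d}{dt}\left[\mathbf v_j^\top\,\frac{d}{d\mathbf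 v_j}\mathbf g(\boldsymbol\vartheta(t))\right]_{t=0},$$ where $\mathbf L_{\cdot k}$ is the $k$th column of $\mathbf L$. Moreover, with $\mathbf J'=\frac{d}{dt}\{\mathbf L^\top\mathbf H(\boldsymbol\vartheta(t))\mathbf L\}|_{t=0}$ and $\mathbf w_j=\mathbf L^{-1}\mathbf v_j$, the sum over $k$ (without the factor $-\tfrac12$) equals $\operatorname{tr}(\mathbf J')$, and the last $t$-derivative (without the factor $\tfrac12$) equals $\mathbf w_j^\top\mathbf J'\mathbf w_j$.
   Context: $\log\pi(\cdot\mid\mathbf y)$ is assumed three times continuously differentiable near $\boldsymbol\vartheta^*$. $\mathbf L$ is any (invertible) $m\times m$ matrix with $\mathbf L\mathbf L^\top=\boldsymbol\Omega$. $\boldsymbol\Omega_{\cdot j}$ denotes the $j$th column of $\boldsymbol\Omega$. $\mathbf H_{-j}(t)$ is the $(m-1)\times(m-1)$ submatrix of $\mathbf H(\boldsymbol\vartheta(t))$ with the $j$th row and column removed. In $\frac{d}{d\mathbf u}\mathbf g(\boldsymbol\vartheta(t))$, the directional derivative of the vector field $\mathbf g$ along $\mathbf u$ is taken first and then evaluated at the point $\boldsymbol\vartheta(t)$. *)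

theory Defs
  imports "HOL-Analysis.Analysis"
begin

definition probability_density :: "('a::euclidean_space \<Rightarrow> real) \<Rightarrow> bool" where
  "probability_density p \<longleftrightarrow>
     p \<in> borel_measurable lborel \<and> (\<forall>x. 0 \<le> p x) \<and> (\<integral>\<^sup>+ x. ennreal (p x) \<partial>lborel) = 1"

definition is_mode :: "('a \<Rightarrow> real) \<Rightarrow> 'a \<Rightarrow> bool" where
  "is_mode p x \<longleftrightarrow> (\<forall>y. p y \<le> p x)"

(* C^k on an open set, by recursion on k through the derivatives along all fixed vectors. *)
primrec Ck_on :: "nat \<Rightarrow> ('a::real_normed_vector \<Rightarrow> 'b::real_normed_vector) \<Rightarrow> 'a set \<Rightarrow> bool" where
  "Ck_on 0 f U \<longleftrightarrow> continuous_on U f"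
| "Ck_on (Suc k) f U \<longleftrightarrow>
     (\<forall>x\<in>U. f differentiable (at x)) \<and>
     (\<forall>v. Ck_on k (\<lambda>x. frechet_derivative f (at x) v) U)"

definition Ck_near :: "nat \<Rightarrow> ('a::real_normed_vector \<Rightarrow> 'b::real_normed_vector) \<Rightarrow> 'a \<Rightarrow> bool" where
  "Ck_near k f x \<longleftrightarrow> (\<exists>U. open U \<and> x \<in> U \<and> Ck_on k f U)"

definition grad :: "(real^'n \<Rightarrow> real) \<Rightarrow> real^'n \<Rightarrow> real^'n" where
  "grad f x = (\<chi> i. frechet_derivative f (at x) (axis i 1))"

lemma GDERIV_grad:
  fixes f :: "real^'n \<Rightarrow> real"
  assumes "f differentiable (at x)"
  shows "GDERIV f x :> grad f x"
proof -
  let ?D = "frechet_derivative f (at x)"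
  have D: "(f has_derivative ?D) (at x)"
    using assms by (simp add: frechet_derivative_works)
  interpret linear ?D
    using D by (rule has_derivative_linear)
  have "?D h = h \<bullet> grad f x" for h
  proof -
    have "?D h = ?D (\<Sum>i\<in>UNIV. h $ i *\<^sub>R axis i 1)"
      using basis_expansion[of h] by (simp add: scalar_mult_eq_scaleR)
    also have "\<dots> = h \<bullet> grad f x"
      by (simp add: sum scale grad_def inner_vec_def)
    finally show ?thesis .
  qed
  hence "?D = (\<lambda>h. h \<bullet> grad f x)" by (rule ext)
  with D show ?thesis by (simp add: gderiv_def)
qed

definition hessian :: "(real^'n \<Rightarrow> real) \<Rightarrow> real^'n \<Rightarrow> real^'n^'n" where
  "hessian f x = jacobian (grad f) (at x)"

definition positive_definite :: "real^'n^'n \<Rightarrow> bool" where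
  "positive_definite A \<longleftrightarrow>
     transpose A = A \<and> (\<forall>x. x \<noteq> 0 \<longrightarrow> 0 < x \<bullet> (A *v x))"

definition dir_deriv ::
    "('a::real_normed_vector \<Rightarrow> 'b::real_normed_vector) \<Rightarrow> 'a \<Rightarrow> 'a \<Rightarrow> 'b" where
  "dir_deriv f u x = vector_derivative (\<lambda>s. f (x + s *\<^sub>R u)) (at 0)"

lemma dir_deriv_eq_jacobian:
  fixes f :: "real^'n \<Rightarrow> real^'m"
  assumes "f differentiable (at x)"
  shows "dir_deriv f u x = jacobian f (at x) *v u"
proof -
  let ?A = "jacobian f (at x)"
  have "(f has_derivative (\<lambda>h. ?A *v h)) (at (x + 0 *\<^sub>R u))"
    using assms by (simp add: jacobian_works)
  moreover have "((\<lambda>s. x + s *\<^sub>R u) has_derivative (\<lambda>s. s *\<^sub>R u)) (at (0::real))"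
    by (auto intro!: derivative_eq_intros)
  ultimately have "((\<lambda>s. f (x + s *\<^sub>R u)) has_derivative (\<lambda>s. ?A *v (s *\<^sub>R u))) (at 0)"
    by (rule has_derivative_compose[rotated])
  hence "((\<lambda>s. f (x + s *\<^sub>R u)) has_vector_derivative (?A *v u)) (at 0)"
    by (simp add: has_vector_derivative_def matrix_vector_mult_scaleR)
  thus ?thesis unfolding dir_deriv_def by (rule vector_derivative_at)
qed

lemma jacobian_uminus_grad:
  assumes "grad f differentiable (at x)"
  shows "jacobian (\<lambda>z. - grad f z) (at x) = - hessian f x"
proof -
  have "(grad f has_derivative (\<lambda>h. hessian f x *v h)) (at x)"
    using assms by (simp add: hessian_def jacobian_works)
  hence "((\<lambda>z. - grad f z) has_derivative (\<lambda>h. - (hessian f x *v h))) (at x)"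
    by (rule has_derivative_minus)
  hence "frechet_derivative (\<lambda>z. - grad f z) (at x) = (\<lambda>h. - (hessian f x *v h))"
    by (rule frechet_derivative_at[symmetric])
  also have "\<dots> = (\<lambda>h. (- hessian f x) *v h)"
    by (simp add: fun_eq_iff vec_eq_iff matrix_vector_mult_def sum_negf)
  finally show ?thesis by (simp add: jacobian_def)
qed

(* The determinant of the submatrix of A with row and column index set S. The Leibniz
   formula (that of det) is used over S itself, because the size card S of the submatrix
   is not the cardinality of a type constructed from 'n, and may be 0 (determinant 1). *)
definition principal_minor :: "'a::comm_ring_1^'n^'n \<Rightarrow> 'n set \<Rightarrow> 'a" where
  "principal_minor A S =
     (\<Sum>p | p permutes S. of_int (sign p) * (\<Prod>i\<in>S. A $ i $ p i))"

lemma principal_minor_empty: "principal_minor A {} = 1"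
  by (simp add: principal_minor_def)

(* For any enumeration h of S by an index type 'k, the principal minor is det of the
   'k-by-'k submatrix. *)
lemma principal_minor_eq_det:
  fixes A :: "'a::comm_ring_1^'n^'n" and h :: "'k::finite \<Rightarrow> 'n"
  assumes h: "bij_betw h UNIV S"
  shows "principal_minor A S = det (\<chi> a b. A $ h a $ h b)"
proof -
  have inj: "inj h" and S: "S = range h"
    using h by (auto simp: bij_betw_def)
  have bij: "bij_betw (map_permutation UNIV h) {p. p permutes UNIV} {p. p permutes S}"
  proof -
    have "map_permutation UNIV h = (\<lambda>p x. if x \<in> S then h (p (inv_into UNIV h x)) else x)"
      by (simp add: fun_eq_iff map_permutation_def restrict_id_def S)
    thus ?thesis using bij_betw_permutations[OF h] by simp
  qed
  have "principal_minor A S =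
      (\<Sum>p | p permutes (UNIV :: 'k set).
         of_int (sign (map_permutation UNIV h p)) * (\<Prod>i\<in>S. A $ i $ map_permutation UNIV h p i))"
    unfolding principal_minor_def by (rule sum.reindex_bij_betw[OF bij, symmetric])
  also have "\<dots> = det (\<chi> a b. A $ h a $ h b)"
    unfolding det_def
  proof (rule sum.cong[OF refl])
    fix p :: "'k \<Rightarrow> 'k"
    assume "p \<in> {p. p permutes UNIV}"
    hence p: "p permutes UNIV" by simp
    have "(\<Prod>i\<in>S. A $ i $ map_permutation UNIV h p i) =
        (\<Prod>a\<in>UNIV. A $ h a $ map_permutation UNIV h p (h a))"
      by (rule prod.reindex_bij_betw[OF h, symmetric])
    also have "\<dots> = (\<Prod>a\<in>UNIV. (\<chi> a b. A $ h a $ h b) $ a $ p a)"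
      using inj by (simp add: map_permutation_def restrict_id_def)
    finally show "of_int (sign (map_permutation UNIV h p)) *
          (\<Prod>i\<in>S. A $ i $ map_permutation UNIV h p i) =
        of_int (sign p) * (\<Prod>a\<in>UNIV. (\<chi> a b. A $ h a $ h b) $ a $ p a)"
      using sign_map_permutation[OF inj p] by simp
  qed
  finally show ?thesis .
qed

end

(* Replacing the j-th row of H by the j-th unit vector turns the principal minor into a full
   determinant, so Jacobi's formula applies. The inverse of the modified matrix agrees with
   Omega - v v^T outside its j-th column, and the j-th column of Omega - v v^T vanishes; hence the
   logarithmic derivative of the minor is tr ((Omega - v v^T) H'), where H' is the derivative of
   H (theta t) at t = 0. Finally tr (Omega H') = tr (L^T H' L) because Omega = L L^T. *)
theory Submission
  imports Defs
begin

section \<open>Cramer's rule and Jacobi's formula for determinants\<close>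

lemma det_replace_row_combination:
  fixes A :: "'a::field^'n^'n"
  shows "det (\<chi> i. if i = k then x v* A else A $ i) = x $ k * det A"
proof -
  have "x v* A = (\<Sum>i\<in>UNIV. x $ i *s row i A)"
    by (simp add: vec_eq_iff vector_matrix_mult_def row_def mult.commute)
  moreover have "row i A = A $ i" for i
    by (simp add: row_def)
  ultimately show ?thesis
    using cramer_lemma_transpose[of k x A] by (simp cong: if_cong)
qed

text \<open>The product rule acts on each term of the Leibniz formula; swapping the two sums groups
  the result by the row that is differentiated.\<close>

lemma det_has_field_derivative_rows:
  fixes A :: "'a::real_normed_field \<Rightarrow> 'a^'n^'n"
  assumes "\<And>i k. ((\<lambda>t. A t $ i $ k) has_field_derivative A' $ i $ k) (at z)"
  shows "((\<lambda>t. det (A t)) has_field_derivative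
           (\<Sum>i\<in>UNIV. det (\<chi> l. if l = i then A' $ i else A z $ l))) (at z)"
proof -
  have "((\<lambda>t. det (A t)) has_field_derivative
      (\<Sum>p | p permutes UNIV. of_int (sign p) *
         (\<Sum>i\<in>UNIV. A' $ i $ p i * (\<Prod>l\<in>UNIV - {i}. A z $ l $ p l)))) (at z)"
    unfolding det_def
    by (intro DERIV_sum DERIV_cmult has_field_derivative_prod assms)
  also have "(\<Sum>p | p permutes UNIV. of_int (sign p) *
         (\<Sum>i\<in>UNIV. A' $ i $ p i * (\<Prod>l\<in>UNIV - {i}. A z $ l $ p l))) =
      (\<Sum>i\<in>UNIV. \<Sum>p | p permutes UNIV. of_int (sign p) *
         (A' $ i $ p i * (\<Prod>l\<in>UNIV - {i}. A z $ l $ p l)))"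
    by (subst sum.swap) (simp add: sum_distrib_left)
  also have "\<dots> = (\<Sum>i\<in>UNIV. det (\<chi> l. if l = i then A' $ i else A z $ l))"
  proof (rule sum.cong[OF refl])
    fix i :: 'n
    have "(\<Prod>l\<in>UNIV. (\<chi> l. if l = i then A' $ i else A z $ l) $ l $ p l) =
        A' $ i $ p i * (\<Prod>l\<in>UNIV - {i}. A z $ l $ p l)" for p :: "'n \<Rightarrow> 'n"
      by (simp add: prod.remove[where A = UNIV and x = i])
    thus "(\<Sum>p | p permutes UNIV. of_int (sign p) *
         (A' $ i $ p i * (\<Prod>l\<in>UNIV - {i}. A z $ l $ p l))) =
        det (\<chi> l. if l = i then A' $ i else A z $ l)"
      by (simp add: det_def)
  qed
  finally show ?thesis .
qed

text \<open>Since \<open>X ** A z = mat 1\<close>, row \<open>i\<close> of \<open>A'\<close> is a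
  combination of the rows of \<open>A z\<close> with coefficients \<open>A' $ i v* X\<close>.
  Cramer's rule keeps only the \<open>i\<close>-th coefficient, a diagonal entry of
  \<open>A' ** X\<close>.\<close>

lemma det_has_field_derivative:
  fixes A :: "'a::real_normed_field \<Rightarrow> 'a^'n^'n"
  assumes A: "\<And>i k. ((\<lambda>t. A t $ i $ k) has_field_derivative A' $ i $ k) (at z)"
    and X: "A z ** X = mat 1"
  shows "((\<lambda>t. det (A t)) has_field_derivative det (A z) * trace (A' ** X)) (at z)"
proof -
  have XA: "X ** A z = mat 1"
    using X matrix_left_right_inverse by blast
  have "det (\<chi> l. if l = i then A' $ i else A z $ l) = (A' ** X) $ i $ i * det (A z)" for i
  proof -
    have "A' $ i = (A' $ i v* X) v* A z"
      by (simp add: vector_matrix_mul_assoc XA)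
    moreover have "(A' $ i v* X) $ i = (A' ** X) $ i $ i"
      by (simp add: vector_matrix_mult_def matrix_matrix_mult_def mult.commute)
    ultimately show ?thesis
      using det_replace_row_combination[of i "A' $ i v* X" "A z"] by (simp cong: if_cong)
  qed
  hence "(\<Sum>i\<in>UNIV. det (\<chi> l. if l = i then A' $ i else A z $ l)) = det (A z) * trace (A' ** X)"
    by (simp add: trace_def sum_distrib_left mult.commute)
  with det_has_field_derivative_rows[OF A] show ?thesis by simp
qed

section \<open>The principal minor with one index removed\<close>

text \<open>The unit row kills every Leibniz term with \<open>p j \<noteq> j\<close>, and the
  permutations fixing \<open>j\<close> are exactly those of \<open>UNIV - {j}\<close>.\<close>

lemma principal_minor_remove:
  fixes A :: "'a::comm_ring_1^'n^'n"
  shows "principal_minor A (UNIV - {j}) = det (\<chi> i. if i = j then axis j 1 else A $ i)"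
    (is "_ = det ?M")
proof -
  have M: "(\<Prod>i\<in>UNIV. ?M $ i $ p i) =
      (if p j = j then \<Prod>i\<in>UNIV - {j}. A $ i $ p i else 0)" for p :: "'n \<Rightarrow> 'n"
    by (simp add: prod.remove[where A = UNIV and x = j] axis_def)
  have perm: "p permutes (UNIV - {j}) \<longleftrightarrow> p permutes UNIV \<and> p j = j" for p :: "'n \<Rightarrow> 'n"
    using permutes_superset[of p UNIV "UNIV - {j}"] permutes_subset[of p "UNIV - {j}" UNIV]
      permutes_not_in[of p "UNIV - {j}" j] by auto
  have "det ?M = (\<Sum>p | p permutes UNIV. if p j = j
      then of_int (sign p) * (\<Prod>i\<in>UNIV - {j}. A $ i $ p i) else 0)"
    unfolding det_def M by (rule sum.cong) auto
  also have "\<dots> = principal_minor A (UNIV - {j})"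
    unfolding principal_minor_def perm
    by (subst sum.inter_filter[symmetric]) (auto simp: finite_permutations)
  finally show ?thesis ..
qed

text \<open>Row \<open>j\<close> of \<open>X\<close> combines the rows of \<open>A\<close> into
  \<open>axis j 1\<close>, so Cramer's rule applies. This later yields positivity of the minor at
  the mode.\<close>

lemma principal_minor_remove_inverse:
  fixes A :: "'a::field^'n^'n"
  assumes "A ** X = mat 1"
  shows "principal_minor A (UNIV - {j}) = X $ j $ j * det A"
proof -
  have "X ** A = mat 1"
    using assms matrix_left_right_inverse by blast
  hence "(X ** A) $ j = axis j 1"
    by (simp add: mat_def axis_def vec_eq_iff)
  hence "X $ j v* A = axis j 1"
    by (simp add: vec_eq_iff vector_matrix_mult_def matrix_matrix_mult_def mult.commute)
  thus ?thesis
    using det_replace_row_combination[of j "X $ j" A]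
    by (simp add: principal_minor_remove cong: if_cong)
qed

lemma principal_minor_remove_has_field_derivative:
  fixes A :: "real \<Rightarrow> real^'n^'n"
  assumes A: "\<And>i k. ((\<lambda>t. A t $ i $ k) has_real_derivative A' $ i $ k) (at z)"
    and X: "A z ** X = mat 1" and Xj: "X $ j $ j \<noteq> 0"
  shows "((\<lambda>t. principal_minor (A t) (UNIV - {j})) has_real_derivative
           principal_minor (A z) (UNIV - {j}) *
             (trace (A' ** X) - row j X \<bullet> (A' *v column j X) / X $ j $ j)) (at z)"
proof -
  define M where "M t = (\<chi> i. if i = j then axis j 1 else A t $ i)" for t
  define M' where "M' = (\<chi> i. if i = j then 0 else A' $ i)"
  define Y where "Y = (\<chi> i k. X $ i $ k + X $ i $ j * (axis j 1 $ k - X $ j $ k) / X $ j $ j)"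
  \<comment> \<open>Y is the inverse of M z, a rank-one correction of X (Sherman-Morrison).\<close>
  have AX: "(\<Sum>l\<in>UNIV. A z $ i $ l * X $ l $ k) = (if i = k then 1 else 0)" for i k
    using X by (simp add: vec_eq_iff matrix_matrix_mult_def mat_def)
  have "M z ** Y = mat 1"
  proof -
    have "(M z ** Y) $ i $ k = mat 1 $ i $ k" for i k
    proof (cases "i = j")
      \<comment> \<open>Row \<open>j\<close> of \<open>M z\<close> is a unit vector, so the entry is
        \<open>Y $ j $ k\<close>; the correction turns row \<open>j\<close> of \<open>X\<close> into
        \<open>axis j 1\<close>.\<close>
      case True
      thus ?thesis
        using Xj by (simp add: M_def Y_def matrix_matrix_mult_def axis_def mat_def
            if_distrib[of "\<lambda>c. c * _"] cong: if_cong)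
    next
      case False
      \<comment> \<open>The second sum is entry \<open>(i, j)\<close> of the identity and vanishes
        because \<open>i \<noteq> j\<close>.\<close>
      have "(M z ** Y) $ i $ k = (\<Sum>l\<in>UNIV. A z $ i $ l * X $ l $ k)
          + (\<Sum>l\<in>UNIV. A z $ i $ l * X $ l $ j) * ((axis j 1 $ k - X $ j $ k) / X $ j $ j)"
        using False by (simp add: M_def Y_def matrix_matrix_mult_def distrib_left sum.distrib
            sum_distrib_right sum_divide_distrib mult.assoc)
      thus ?thesis
        using False by (simp add: AX mat_def)
    qed
    thus ?thesis by (simp add: vec_eq_iff)
  qed
  moreover have "((\<lambda>t. M t $ i $ k) has_real_derivative M' $ i $ k) (at z)" for i k
    using A by (cases "i = j") (simp_all add: M_def M'_def)
  ultimately have D: "((\<lambda>t. det (M t)) has_real_derivative det (M z) * trace (M' ** Y)) (at z)"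
    by (intro det_has_field_derivative)
  have "(M' ** Y) $ i $ i = (A' ** X) $ i $ i - X $ j $ i * (A' *v column j X) $ i / X $ j $ j" for i
  proof (cases "i = j")
    \<comment> \<open>Both sides are zero: row \<open>j\<close> of \<open>M'\<close> vanishes, and
      on the right \<open>X $ j $ j\<close> cancels.\<close>
    case True
    thus ?thesis
      using Xj by (simp add: M'_def matrix_matrix_mult_def matrix_vector_mult_def column_def)
  next
    case False
    have "(M' ** Y) $ i $ i = (\<Sum>l\<in>UNIV. A' $ i $ l * X $ l $ i
        - X $ j $ i * (A' $ i $ l * X $ l $ j) / X $ j $ j)"
      using False by (simp add: M'_def Y_def matrix_matrix_mult_def axis_def algebra_simps)
    thus ?thesis
      by (simp add: matrix_matrix_mult_def matrix_vector_mult_def column_def sum_subtractf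
          sum_distrib_left sum_divide_distrib)
  qed
  hence "trace (M' ** Y) = trace (A' ** X) - row j X \<bullet> (A' *v column j X) / X $ j $ j"
    by (simp add: trace_def inner_vec_def row_def sum_subtractf sum_divide_distrib)
  thus ?thesis
    using D by (simp add: principal_minor_remove M_def)
qed

lemma positive_definite_invertible:
  fixes A :: "real^'n^'n"
  assumes "positive_definite A"
  shows "invertible A"
proof -
  have "x = 0" if "A *v x = 0" for x
    using assms that by (auto simp: positive_definite_def dest: spec[of _ x])
  thus ?thesis
    by (simp add: invertible_left_inverse matrix_left_invertible_ker)
qed

lemma matrix_inv_right:
  assumes "invertible A"
  shows "A ** matrix_inv A = mat 1"
  using assms unfolding invertible_def matrix_inv_def by (rule someI2_ex) simp

section \<open>Differentiability of the gradient and the Hessian entries\<close>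

lemma grad_has_derivative:
  fixes f :: "real^'n \<Rightarrow> real"
  assumes "\<And>v. (\<lambda>y. frechet_derivative f (at y) v) differentiable (at x)"
  shows "(grad f has_derivative
    (\<lambda>h. \<chi> i. frechet_derivative (\<lambda>y. frechet_derivative f (at y) (axis i 1)) (at x) h)) (at x)"
  using assms
  by (subst has_derivative_componentwise_within)
    (auto simp: Basis_vec_def inner_axis grad_def frechet_derivative_works[symmetric])

lemma hessian_component:
  fixes f :: "real^'n \<Rightarrow> real"
  assumes "\<And>v. (\<lambda>y. frechet_derivative f (at y) v) differentiable (at x)"
  shows "hessian f x $ i $ k =
    frechet_derivative (\<lambda>y. frechet_derivative f (at y) (axis i 1)) (at x) (axis k 1)"
  by (simp add: hessian_def jacobian_def matrix_def
      frechet_derivative_at[OF grad_has_derivative[OF assms], symmetric])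

text \<open>\<open>Ck_on\<close> speaks of iterated derivatives along fixed vectors. Along
  coordinate axes the first ones are the entries of the gradient and the second ones those of the
  Hessian; the third order makes the latter differentiable.\<close>

lemma Ck_near_3_grad_hessian:
  fixes f :: "real^'n \<Rightarrow> real"
  assumes "Ck_near 3 f x"
  obtains U where "open U" "x \<in> U" "\<And>y. y \<in> U \<Longrightarrow> grad f differentiable (at y)"
    "\<And>y i k. y \<in> U \<Longrightarrow> (\<lambda>z. hessian f z $ i $ k) differentiable (at y)"
proof -
  obtain U where U: "open U" "x \<in> U" "Ck_on (Suc (Suc (Suc 0))) f U"
    using assms by (auto simp: Ck_near_def numeral_3_eq_3)
  have D2: "(\<lambda>z. frechet_derivative f (at z) v) differentiable (at y)" if "y \<in> U" for y v
    using U(3) that by simp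
  have D3: "(\<lambda>z. frechet_derivative (\<lambda>z. frechet_derivative f (at z) v) (at z) w)
      differentiable (at y)" if "y \<in> U" for y v w
    using U(3) that by simp
  show ?thesis
  proof (rule that[OF U(1,2)])
    show "grad f differentiable (at y)" if "y \<in> U" for y
      using grad_has_derivative[OF D2[OF that]] by (auto simp: differentiable_def)
    \<comment> \<open>The entry formula is available only at points of \<open>U\<close>, so the
      derivative is transferred between functions that agree on this open set.\<close>
    show "(\<lambda>z. hessian f z $ i $ k) differentiable (at y)" if "y \<in> U" for y i k
      using D3[OF that, of "axis i 1" "axis k 1"] hessian_component[OF D2] that U(1)
      unfolding differentiable_def
      by (metis (no_types, lifting) has_derivative_transform_within_open)
  qed
qed

lemma has_vector_derivative_matrixI:
  fixes A :: "real \<Rightarrow> real^'n^'m"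
  assumes "\<And>i k. ((\<lambda>t. A t $ i $ k) has_real_derivative A' $ i $ k) (at z)"
  shows "(A has_vector_derivative A') (at z)"
  unfolding has_vector_derivative_def
  using assms
  by (subst has_derivative_componentwise_within)
    (auto simp: Basis_vec_def inner_axis has_field_derivative_def mult_commute_abs)

section \<open>The volume slope along the curve through the mode\<close>

theorem corollary3p3:
  fixes \<pi> :: "real^'m \<Rightarrow> real" and mode :: "real^'m"
    and g :: "real^'m \<Rightarrow> real^'m" and H :: "real^'m \<Rightarrow> real^'m^'m"
    and \<Omega> L J' :: "real^'m^'m" and j :: 'm and v w :: "real^'m"
    and \<theta> :: "real \<Rightarrow> real^'m" and vol :: "real \<Rightarrow> real" and \<gamma>' :: real
    and B :: "real^'m \<Rightarrow> real \<Rightarrow> real"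
  assumes "probability_density \<pi>"
    and "is_mode \<pi> mode"
    and "\<forall>\<^sub>F x in nhds mode. 0 < \<pi> x"
    and "Ck_near 3 (\<lambda>x. ln (\<pi> x)) mode"
    and "g = (\<lambda>x. - grad (\<lambda>z. ln (\<pi> z)) x)"
    and "H = (\<lambda>x. - hessian (\<lambda>z. ln (\<pi> z)) x)"
    and "positive_definite (H mode)"
    and "\<Omega> = matrix_inv (H mode)"
    and "invertible L"
    and "\<Omega> = L ** transpose L"
    and "v = (1 / sqrt (\<Omega> $ j $ j)) *\<^sub>R column j \<Omega>"
    and "\<theta> = (\<lambda>t. mode + t *\<^sub>R v)"
    and "vol = (\<lambda>t. - (1/2) * ln (principal_minor (H (\<theta> t)) (UNIV - {j})))"
    and "\<gamma>' = deriv vol 0"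
    and "B = (\<lambda>u t. u \<bullet> dir_deriv g u (\<theta> t))"
    and "J' = vector_derivative (\<lambda>t. transpose L ** H (\<theta> t) ** L) (at 0)"
    and "w = matrix_inv L *v v"
  shows "vol differentiable (at 0)
    \<and> (\<forall>k. B (column k L) differentiable (at 0))
    \<and> B v differentiable (at 0)
    \<and> (\<lambda>t. transpose L ** H (\<theta> t) ** L) differentiable (at 0)
    \<and> \<gamma>' = - (1/2) * (\<Sum>k\<in>UNIV. deriv (B (column k L)) 0) + (1/2) * deriv (B v) 0
    \<and> (\<Sum>k\<in>UNIV. deriv (B (column k L)) 0) = trace J'
    \<and> deriv (B v) 0 = w \<bullet> (J' *v w)"
proof -
  let ?f = "\<lambda>x. ln (\<pi> x)"
  obtain U where U: "open U" "mode \<in> U"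
    and grad: "\<And>x. x \<in> U \<Longrightarrow> grad ?f differentiable (at x)"
    and hess: "\<And>x i k. x \<in> U \<Longrightarrow> (\<lambda>z. hessian ?f z $ i $ k) differentiable (at x)"
    using Ck_near_3_grad_hessian[OF assms(4)] by blast
  have \<theta>0: "\<theta> 0 = mode"
    by (simp add: assms(12))
  have \<theta>D: "(\<theta> has_derivative (\<lambda>s. s *\<^sub>R v)) (at 0)"
    unfolding assms(12) by (auto intro!: derivative_eq_intros)
  \<comment> \<open>The formula for \<open>dir_deriv g\<close> is available only on
    \<open>U\<close>; agreement for \<open>t\<close> near 0 suffices for derivatives at 0.\<close>
  have \<theta>U: "\<forall>\<^sub>F t in nhds 0. \<theta> t \<in> U"
  proof -
    have "isCont \<theta> 0"
      using \<theta>D by (rule has_derivative_continuous)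
    hence "(\<theta> \<longlongrightarrow> mode) (nhds 0)"
      by (simp add: isCont_def tendsto_nhds_iff \<theta>0)
    thus ?thesis
      using U by (rule topological_tendstoD)
  qed
  define H' where "H' = (\<chi> i k. deriv (\<lambda>t. H (\<theta> t) $ i $ k) 0)"
  have HD: "((\<lambda>t. H (\<theta> t) $ i $ k) has_real_derivative H' $ i $ k) (at 0)" for i k
  proof -
    have "(\<lambda>x. H x $ i $ k) differentiable (at (\<theta> 0))"
      unfolding assms(6) using hess[OF U(2)] by (simp add: \<theta>0)
    moreover have "\<theta> differentiable (at 0)"
      using \<theta>D by (auto simp: differentiable_def)
    ultimately have "(\<lambda>t. H (\<theta> t) $ i $ k) differentiable (at 0)"
      using differentiable_chain_at[of \<theta> 0 "\<lambda>x. H x $ i $ k"] by (simp add: o_def)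
    thus ?thesis
      by (simp add: H'_def DERIV_deriv_iff_real_differentiable)
  qed
  have gD: "dir_deriv g u x = H x *v u" if "x \<in> U" for x u
    using grad[OF that] unfolding assms(5,6)
    by (simp add: dir_deriv_eq_jacobian jacobian_uminus_grad)
  \<comment> \<open>Near 0, \<open>B u\<close> is the quadratic form of
    \<open>H (\<theta> t)\<close> at \<open>u\<close>. Keeping \<open>u\<close> arbitrary covers
    both the columns of \<open>L\<close> and \<open>v\<close>.\<close>
  have BD: "(B u has_real_derivative u \<bullet> (H' *v u)) (at 0)" for u
  proof -
    have "((\<lambda>t. u \<bullet> (H (\<theta> t) *v u)) has_real_derivative u \<bullet> (H' *v u)) (at 0)"
      unfolding inner_vec_def matrix_vector_mult_def inner_real_def vec_lambda_beta
      by (intro DERIV_sum DERIV_cmult DERIV_cmult_right HD)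
    moreover have "\<forall>\<^sub>F t in nhds 0. B u t = u \<bullet> (H (\<theta> t) *v u)"
      using \<theta>U by eventually_elim (simp add: assms(15) gD)
    ultimately show ?thesis
      using DERIV_cong_ev[OF refl _ refl, of "B u" "\<lambda>t. u \<bullet> (H (\<theta> t) *v u)" 0] by simp
  qed
  have JD: "((\<lambda>t. transpose L ** H (\<theta> t) ** L) has_vector_derivative
      transpose L ** H' ** L) (at 0)"
    unfolding matrix_matrix_mult_def
    by (rule has_vector_derivative_matrixI)
      (auto simp: intro!: DERIV_sum DERIV_cmult DERIV_cmult_right HD)
  hence J': "J' = transpose L ** H' ** L"
    unfolding assms(16) by (rule vector_derivative_at)
  have H\<Omega>: "H (\<theta> 0) ** \<Omega> = mat 1"
    unfolding assms(8) \<theta>0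
    by (intro matrix_inv_right positive_definite_invertible assms(7))
  have \<Omega>sym: "\<Omega> $ i $ k = \<Omega> $ k $ i" for i k
    by (simp add: assms(10) matrix_matrix_mult_def transpose_def mult.commute)
  have detL: "det L \<noteq> 0"
    using assms(9) by (simp add: invertible_det_nz)
  \<comment> \<open>Positivity of the determinant follows from
    \<open>\<Omega> = L ** transpose L\<close>, whose determinant is a nonzero square.\<close>
  have "det (H (\<theta> 0)) * (det L)\<^sup>2 = 1"
    using arg_cong[OF H\<Omega>, of det] by (simp add: assms(10) det_mul power2_eq_square)
  hence detH: "0 < det (H (\<theta> 0))"
    using detL by (metis zero_less_mult_pos2 zero_less_one zero_less_power2)
  \<comment> \<open>This entry is the squared norm of row \<open>j\<close> of \<open>L\<close>,
    which is nonzero as \<open>L\<close> is invertible.\<close>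
  have \<Omega>jj: "0 < \<Omega> $ j $ j"
  proof -
    have "L $ j \<noteq> 0"
      using detL det_zero_row(2)[of j L] by (auto simp: row_def)
    moreover have "\<Omega> $ j $ j = L $ j \<bullet> L $ j"
      by (simp add: assms(10) matrix_matrix_mult_def transpose_def inner_vec_def)
    ultimately show ?thesis by simp
  qed
  \<comment> \<open>The two factors \<open>1 / sqrt (\<Omega> $ j $ j)\<close> in \<open>v\<close>
    multiply to the denominator of the rank-one correction, and symmetry of \<open>\<Omega>\<close>
    identifies its row with its column.\<close>
  have vv: "v \<bullet> (H' *v v) = row j \<Omega> \<bullet> (H' *v column j \<Omega>) / \<Omega> $ j $ j"
  proof -
    have "row j \<Omega> = column j \<Omega>"
      by (simp add: row_def column_def vec_eq_iff \<Omega>sym)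
    thus ?thesis
      using \<Omega>jj by (simp add: assms(11) matrix_vector_mult_scaleR)
  qed
  define P where "P t = principal_minor (H (\<theta> t)) (UNIV - {j})" for t
  \<comment> \<open>The chain rule for \<open>ln\<close> needs a positive minor at 0; its derivative
    then cancels the factor \<open>P 0\<close> in \<open>PD\<close>.\<close>
  have P0: "0 < P 0"
    using principal_minor_remove_inverse[OF H\<Omega>, of j] \<Omega>jj detH by (simp add: P_def)
  have PD: "(P has_real_derivative P 0 * (trace (H' ** \<Omega>) - v \<bullet> (H' *v v))) (at 0)"
    unfolding P_def vv
    by (rule principal_minor_remove_has_field_derivative) (use HD H\<Omega> \<Omega>jj in auto)
  have volD: "(vol has_real_derivative - (1/2) * (trace (H' ** \<Omega>) - v \<bullet> (H' *v v))) (at 0)"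
    using DERIV_cmult[OF DERIV_ln_divide[THEN DERIV_chain2, OF P0 PD], of "-(1/2)"] P0
    unfolding assms(13) P_def[symmetric] by simp
  \<comment> \<open>The \<open>k\<close>-th diagonal entry of \<open>transpose L ** H' ** L\<close>
    is the quadratic form of \<open>H'\<close> at column \<open>k\<close> of
    \<open>L\<close>.\<close>
  have tr: "(\<Sum>k\<in>UNIV. column k L \<bullet> (H' *v column k L)) = trace (transpose L ** H' ** L)"
    unfolding trace_def matrix_mul_assoc[symmetric]
    by (rule sum.cong) (simp_all add: inner_vec_def column_def transpose_def matrix_vector_mult_def
        matrix_matrix_mult_def)
  \<comment> \<open>Cyclicity of the trace brings \<open>L\<close> and \<open>transpose L\<close>
    together as \<open>\<Omega>\<close>.\<close>
  have tr\<Omega>: "trace (transpose L ** H' ** L) = trace (H' ** \<Omega>)"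
    unfolding assms(10) by (metis trace_mul_sym matrix_mul_assoc)
  have Lw: "L *v w = v"
    unfolding assms(17) by (simp add: matrix_vector_mul_assoc matrix_inv_right assms(9))
  \<comment> \<open>Moving \<open>transpose L\<close> across the inner product leaves the quadratic
    form of \<open>H'\<close> at \<open>L *v w = v\<close>.\<close>
  have ww: "w \<bullet> (J' *v w) = v \<bullet> (H' *v v)"
  proof -
    have "w \<bullet> (J' *v w) = w \<bullet> (transpose L *v (H' *v (L *v w)))"
      unfolding J' by (simp only: matrix_vector_mul_assoc matrix_mul_assoc)
    also have "\<dots> = (L *v w) \<bullet> (H' *v (L *v w))"
      by (simp only: dot_lmul_matrix[symmetric] vector_transpose_matrix)
    finally show ?thesis by (simp only: Lw)
  qed
  have "vol differentiable (at 0)" "\<And>u. B u differentiable (at 0)"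
    using volD BD by (auto simp: real_differentiable_def)
  moreover have "(\<lambda>t. transpose L ** H (\<theta> t) ** L) differentiable (at 0)"
    using JD by (rule differentiableI_vector)
  moreover have "deriv (B u) 0 = u \<bullet> (H' *v u)" for u
    using BD by (rule DERIV_imp_deriv)
  moreover have "\<gamma>' = - (1/2) * (trace (H' ** \<Omega>) - v \<bullet> (H' *v v))"
    unfolding assms(14) using volD by (rule DERIV_imp_deriv)
  ultimately show ?thesis
    by (simp add: ww tr) (simp add: J' tr\<Omega> diff_divide_distrib)
qed

end
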